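(* Let $G\in\mathcal{G}$, let $\omega$ be an arbitrary presentation of $G$ in the alphabet $\mathcal{A}$, and let $\beta_1(\omega)$ be the number of symbols $\mathbb{Z}$ in $\omega$. Then there are isomorphisms $$Z(G)\cong G/[G,G]\cong \mathbb{Z}^{\beta_1(\omega)}.$$ In particular, the number $\beta_1(\omega)$ depends only on the group $G$.
   Context: $Z(G)$ denotes the center and $[G,G]$ the commutator subgroup of a group $G$. For a group $A$ and an integer $n\ge 1$, the wreath product $A\wr_n\mathbb{Z}$ is the semidirect product $A^n\rtimes_\varphi\mathbb{Z}$, where $\varphi\colon\mathbb{Z}\to\operatorname{Aut}(A^n)$ is the action by cyclic shifts of coordinates: $\varphi(k)(a_0,\dots,a_{n-1})=(a_{k \bmod n},a_{(1+k)\bmod n},\dots,a_{(n-1+k) \bmod n})$. In particular $A\wr_1\mathbb{Z}=A\times\mathbb{Z}$ and $1\wr_n\mathbb{Z}=\mathbb{Z}$. $\mathcal{G}$ is the minimal class of groups (considered up to isomorphism) such that: (1) the trivial group $1$ belongs to $\mathcal{G}$; (2) if $A,B\in\mathcal{G}$ then $A\times B\in\mathcal{G}$; (3) if $A\in\mathcal{G}$ and $n\ge 1$ then $A\wr_n\mathbb{Z}\in\mathcal{G}$. Every $G\in\mathcal{G}$ can be written as a word in the alphabet $\mathcal{A}=\{1,\mathbb{Z},(,),\times,\wr_2,\wr_3,\wr_4,\dots\}$; such a word is called a presentation of $G$ in the alphabet $\mathcal{A}$. That is, a presentation is an expression built from the symbols $1$ and $\mathbb{Z}$ by finitely many operations $(\alpha,\beta)\mapsto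 \alpha\times\beta$ and $\alpha\mapsto\alpha\wr_n\mathbb{Z}$ ($n\ge2$), with brackets where needed, such that the group it determines is isomorphic to $G$. Presentations are not unique. The number $\beta_1(\omega)$ counts all occurrences of the symbol $\mathbb{Z}$ in the word, including those occurring in $\wr_n\mathbb{Z}$; so $\beta_1(1)=0$, $\beta_1(\mathbb{Z})=1$, $\beta_1(\alpha\times\beta)=\beta_1(\alpha)+\beta_1(\beta)$, $\beta_1(\alpha\wr_n\mathbb{Z})=\beta_1(\alpha)+1$. *)

theory Defs
  imports "HOL-Algebra.Algebra"
begin

definition semidirect_product ::
    "('a, 'c) monoid_scheme \<Rightarrow> ('b, 'd) monoid_scheme \<Rightarrow> ('b \<Rightarrow> 'a \<Rightarrow> 'a) \<Rightarrow> ('a \<times> 'b) monoid" where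
  "semidirect_product N H \<phi> =
     \<lparr>carrier = carrier N \<times> carrier H,
      monoid.mult = (\<lambda>(a, h) (b, k). (a \<otimes>\<^bsub>N\<^esub> \<phi> h b, h \<otimes>\<^bsub>H\<^esub> k)),
      one = (\<one>\<^bsub>N\<^esub>, \<one>\<^bsub>H\<^esub>)\<rparr>"

definition cyclic_shift :: "nat \<Rightarrow> int \<Rightarrow> (nat \<Rightarrow> 'a) \<Rightarrow> nat \<Rightarrow> 'a" where
  "cyclic_shift n k a = (\<lambda>i\<in>{..<n}. a (nat ((int i + k) mod int n)))"

text \<open>The wreath product \<open>A \<wr>\<^sub>n \<int>\<close>; it is only meaningful for \<open>n \<ge> 1\<close>.\<close>

definition wreath_int :: "('a, 'c) monoid_scheme \<Rightarrow> nat \<Rightarrow> ((nat \<Rightarrow> 'a) \<times> int) monoid" where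
  "wreath_int A n = semidirect_product (product_group {..<n} (\<lambda>_. A)) integer_group (cyclic_shift n)"

definition center :: "('a, 'c) monoid_scheme \<Rightarrow> 'a set" where
  "center G = {z \<in> carrier G. \<forall>g \<in> carrier G. z \<otimes>\<^bsub>G\<^esub> g = g \<otimes>\<^bsub>G\<^esub> z}"

text \<open>
  The class \<open>\<G>\<close>, closed under isomorphism. Keeping \<open>A\<close>, \<open>B\<close> and \<open>G\<close> on the same type \<open>'a\<close> loses no
  members: \<open>A\<close> and \<open>B\<close> embed in \<open>A \<times> B\<close>, and \<open>A\<close> embeds in \<open>A \<wr>\<^sub>n \<int>\<close>, so if \<open>G\<close> has its carrier
  in \<open>'a\<close>, then so do isomorphic copies of the factors.
\<close>

inductive wreath_class :: "'a monoid \<Rightarrow> bool" where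
  trivial: "trivial_group G \<Longrightarrow> wreath_class G"
| product: "\<lbrakk>wreath_class A; wreath_class B; group G; G \<cong> A \<times>\<times> B\<rbrakk> \<Longrightarrow> wreath_class G"
| wreath: "\<lbrakk>wreath_class A; 1 \<le> n; group G; G \<cong> wreath_int A n\<rbrakk> \<Longrightarrow> wreath_class G"

text \<open>
  Words in the alphabet \<open>{1, \<int>, (, ), \<times>, \<wr>\<^sub>2, \<wr>\<^sub>3, \<dots>}\<close>, as expression trees; \<open>WWreath \<alpha> n\<close> is
  \<open>\<alpha> \<wr>\<^sub>n \<int>\<close>, and \<open>valid_word\<close> restricts the indices to \<open>n \<ge> 2\<close>.
\<close>

datatype word = WOne | WInt | WProd word word | WWreath word nat

primrec valid_word :: "word \<Rightarrow> bool" where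
  "valid_word WOne \<longleftrightarrow> True"
| "valid_word WInt \<longleftrightarrow> True"
| "valid_word (WProd \<alpha> \<beta>) \<longleftrightarrow> valid_word \<alpha> \<and> valid_word \<beta>"
| "valid_word (WWreath \<alpha> n) \<longleftrightarrow> valid_word \<alpha> \<and> 2 \<le> n"

primrec \<beta>\<^sub>1 :: "word \<Rightarrow> nat" where
  "\<beta>\<^sub>1 WOne = 0"
| "\<beta>\<^sub>1 WInt = 1"
| "\<beta>\<^sub>1 (WProd \<alpha> \<beta>) = \<beta>\<^sub>1 \<alpha> + \<beta>\<^sub>1 \<beta>"
| "\<beta>\<^sub>1 (WWreath \<alpha> n) = \<beta>\<^sub>1 \<alpha> + 1"

text \<open>
  The element type of the group determined by a word depends on the word, so the elements are
  collected in one type. Each constructor is injective, hence \<open>image_group\<close> below is transport of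
  structure along a bijection.
\<close>

datatype elt = EOne | EInt int | EPair elt elt | EWreath "nat \<Rightarrow> elt" int

primrec word_group :: "word \<Rightarrow> elt monoid" where
  "word_group WOne = singleton_group EOne"
| "word_group WInt = image_group EInt integer_group"
| "word_group (WProd \<alpha> \<beta>) = image_group (\<lambda>(x, y). EPair x y) (word_group \<alpha> \<times>\<times> word_group \<beta>)"
| "word_group (WWreath \<alpha> n) = image_group (\<lambda>(a, k). EWreath a k) (wreath_int (word_group \<alpha>) n)"

definition presentation :: "word \<Rightarrow> ('a, 'c) monoid_scheme \<Rightarrow> bool" where
  "presentation \<omega> G \<longleftrightarrow> valid_word \<omega> \<and> word_group \<omega> \<cong> G"

end

theory Submission
  imports Defs
begin

text \<open>
  By induction on the word, both the center and the abelianization are free abelian of rank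
  \<open>\<beta>\<^sub>1\<close>. Both are compatible with direct products. In \<open>A \<wr>\<^sub>n \<int>\<close> an element commuting with all shifts
  is constant on coordinates, so the center consists of the pairs of a constant central tuple and a
  multiple of \<open>n\<close> (any integer, if \<open>A\<close> is trivial), that is \<open>Z(A) \<times> \<int>\<close>. Modulo commutators an entry
  can be shifted to coordinate \<open>0\<close>, so the abelianization sends \<open>(a, k)\<close> to the product of
  the classes of the \<open>a\<^sub>i\<close> together with \<open>k\<close>. Invariance of \<open>\<beta>\<^sub>1\<close> is the invariance of the rank of a
  free abelian group.
\<close>

section \<open>Free abelian groups of finite rank\<close>

abbreviation int_lattice :: "nat \<Rightarrow> (nat \<Rightarrow> int) monoid" where
  "int_lattice m \<equiv> product_group {..<m} (\<lambda>_. integer_group)"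

lemma comm_group_int_lattice: "comm_group (int_lattice m)"
proof -
  interpret group "int_lattice m" by simp
  show ?thesis
    by (rule group_comm_groupI) (auto simp: add.commute)
qed

lemma int_lattice_0: "int_lattice 0 \<cong> singleton_group x"
  by (rule is_isoI[of "\<lambda>_. x"], rule isoI)
     (auto simp: hom_def singleton_group_def bij_betw_def)

lemma int_lattice_1: "int_lattice 1 \<cong> integer_group"
proof (rule is_isoI[of "\<lambda>f. f 0"], rule isoI)
  show "(\<lambda>f. f 0) \<in> hom (int_lattice 1) integer_group"
    by (auto simp: hom_def)
  show "bij_betw (\<lambda>f. f 0) (carrier (int_lattice 1)) (carrier integer_group)"
    by (rule bij_betw_byWitness[where f' = "\<lambda>k. \<lambda>i\<in>{..<1}. k"])
       (auto simp: fun_eq_iff PiE_iff extensional_def)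
qed

text \<open>Concatenation of tuples; the inverse cuts at position \<open>a\<close>.\<close>

lemma int_lattice_add: "int_lattice a \<times>\<times> int_lattice b \<cong> int_lattice (a + b)"
proof (rule is_isoI, rule isoI)
  let ?h = "\<lambda>(f, g). \<lambda>i\<in>{..<a+b}. if i < a then f i else g (i - a :: nat) :: int"
  show hom: "?h \<in> hom (int_lattice a \<times>\<times> int_lattice b) (int_lattice (a + b))"
  proof (rule homI)
    fix p q assume "p \<in> carrier (int_lattice a \<times>\<times> int_lattice b)"
      "q \<in> carrier (int_lattice a \<times>\<times> int_lattice b)"
    show "?h (p \<otimes>\<^bsub>int_lattice a \<times>\<times> int_lattice b\<^esub> q) = ?h p \<otimes>\<^bsub>int_lattice (a + b)\<^esub> ?h q"
      \<comment> \<open>For \<open>i \<ge> a\<close> the second tuple is read at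
        \<open>i - a\<close>; the bound \<open>i < a + b\<close> has to become
        \<open>i - a < b\<close> before the restricted sum evaluates there.\<close>
      by (cases p; cases q) (simp add: fun_eq_iff, metis less_diff_conv2 add.commute not_less)
  qed (simp add: case_prod_beta)
  show "bij_betw ?h (carrier (int_lattice a \<times>\<times> int_lattice b)) (carrier (int_lattice (a + b)))"
  proof (rule bij_betw_byWitness[where f' = "\<lambda>h. (\<lambda>i\<in>{..<a}. h i, \<lambda>i\<in>{..<b}. h (i + a))"])
    show "\<forall>h\<in>carrier (int_lattice (a + b)).
        ?h (\<lambda>i\<in>{..<a}. h i, \<lambda>i\<in>{..<b}. h (i + a)) = h"
      by (auto simp: fun_eq_iff PiE_iff extensional_def)
    show "\<forall>p\<in>carrier (int_lattice a \<times>\<times> int_lattice b).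
        (\<lambda>i\<in>{..<a}. ?h p i, \<lambda>i\<in>{..<b}. ?h p (i + a)) = p"
    proof
      fix p assume "p \<in> carrier (int_lattice a \<times>\<times> int_lattice b)"
      then obtain f g where "p = (f, g)" "f \<in> extensional {..<a}" "g \<in> extensional {..<b}"
        by (auto simp: PiE_def)
      then show "(\<lambda>i\<in>{..<a}. ?h p i, \<lambda>i\<in>{..<b}. ?h p (i + a)) = p"
        by (simp add: fun_eq_iff extensional_def)
    qed
    show "?h ` carrier (int_lattice a \<times>\<times> int_lattice b) \<subseteq> carrier (int_lattice (a + b))"
      using hom unfolding hom_def by blast
    show "(\<lambda>h. (\<lambda>i\<in>{..<a}. h i, \<lambda>i\<in>{..<b}. h (i + a))) ` carrier (int_lattice (a + b))
        \<subseteq> carrier (int_lattice a \<times>\<times> int_lattice b)"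
      by (rule image_subsetI) (simp add: restrict_PiE_iff)
  qed
qed

text \<open>The lattice is free abelian on \<open>{..<m}\<close>, and isomorphic free abelian groups
  have equipollent bases.\<close>

lemma int_lattice_iso_imp_eq:
  assumes "int_lattice m \<cong> int_lattice m'"
  shows "m = m'"
proof -
  have sum: "int_lattice k \<cong> free_Abelian_group {..<k}" for k
  proof -
    \<comment> \<open>The index set is finite, so the finite-support condition of the direct sum
      holds for every tuple.\<close>
    have "sum_group {..<k} (\<lambda>_. integer_group) = int_lattice k"
      using group.subgroup_generated_group_carrier[of "int_lattice k"]
      by (simp add: sum_group_def)
    then show ?thesis
      using isomorphic_sum_integer_group[of "{..<k}"] by simp
  qed
  have "free_Abelian_group {..<m} \<cong> int_lattice m"
    using group.iso_sym[OF _ sum] by simp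
  also note assms
  also note sum
  finally have "{..<m} \<approx> {..<m'}"
    by (simp add: isomorphic_free_Abelian_groups)
  then show ?thesis
    by (metis card_lessThan eqpoll_iff_card finite_lessThan)
qed

section \<open>The center\<close>

abbreviation center_group :: "('a, 'c) monoid_scheme \<Rightarrow> ('a, 'c) monoid_scheme" where
  "center_group G \<equiv> G\<lparr>carrier := center G\<rparr>"

lemma center_carrier: "z \<in> center G \<Longrightarrow> z \<in> carrier G"
  unfolding center_def by blast

lemma center_comm: "z \<in> center G \<Longrightarrow> g \<in> carrier G \<Longrightarrow> z \<otimes>\<^bsub>G\<^esub> g = g \<otimes>\<^bsub>G\<^esub> z"
  unfolding center_def by blast

lemma centerI:
  assumes "z \<in> carrier G" "\<And>g. g \<in> carrier G \<Longrightarrow> z \<otimes>\<^bsub>G\<^esub> g = g \<otimes>\<^bsub>G\<^esub> z"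
  shows "z \<in> center G"
  using assms unfolding center_def by blast

lemma (in group) subgroup_center: "subgroup (center G) G"
proof (rule subgroupI)
  show "center G \<subseteq> carrier G"
    by (auto dest: center_carrier)
  show "center G \<noteq> {}"
    using centerI[OF one_closed] by force
next
  fix a assume a: "a \<in> center G"
  have ac: "a \<in> carrier G"
    using a by (rule center_carrier)
  show "inv a \<in> center G"
  proof (rule centerI)
    fix g assume g: "g \<in> carrier G"
    \<comment> \<open>Inserting \<open>inv a \<otimes> a\<close> lets the central \<open>a\<close>
      move to the front, where it can be cancelled.\<close>
    have "g = g \<otimes> inv a \<otimes> a"
      using ac g by (simp add: m_assoc)
    also have "\<dots> = a \<otimes> (g \<otimes> inv a)"
      using a ac g by (intro center_comm[symmetric]) auto
    finally show "inv a \<otimes> g = g \<otimes> inv a"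
      using ac g by (simp add: inv_solve_left')
  qed (use ac in simp)
  fix b assume b: "b \<in> center G"
  have bc: "b \<in> carrier G"
    using b by (rule center_carrier)
  show "a \<otimes> b \<in> center G"
  proof (rule centerI)
    fix g assume g: "g \<in> carrier G"
    have "a \<otimes> b \<otimes> g = a \<otimes> g \<otimes> b"
      using ac bc g by (simp add: m_assoc center_comm[OF b g])
    then show "a \<otimes> b \<otimes> g = g \<otimes> (a \<otimes> b)"
      using ac bc g by (simp add: center_comm[OF a g] m_assoc)
  qed (use ac bc in simp)
qed

lemma group_center: "group G \<Longrightarrow> group (center_group G)"
  by (simp add: group.subgroup_center group.subgroup_imp_group)

lemma center_group_iso:
  assumes "group G" "G \<cong> H"
  shows "center_group G \<cong> center_group H"
proof -
  interpret G: group G by fact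
  obtain f where f: "f \<in> iso G H" using assms by (auto simp: is_iso_def)
  then have hom: "f \<in> hom G H" and bij: "bij_betw f (carrier G) (carrier H)"
    by (auto simp: iso_def)
  have im: "f ` carrier G = carrier H" and inj: "inj_on f (carrier G)"
    using bij by (auto simp: bij_betw_def)
  have mult: "f (x \<otimes>\<^bsub>G\<^esub> y) = f x \<otimes>\<^bsub>H\<^esub> f y" if "x \<in> carrier G" "y \<in> carrier G" for x y
    using hom that by (rule hom_mult)
  \<comment> \<open>Injectivity reflects each commutation equation, and surjectivity makes the
    \<open>f y\<close> exhaust \<open>carrier H\<close>.\<close>
  have iff: "f x \<in> center H \<longleftrightarrow> x \<in> center G" if "x \<in> carrier G" for x
  proof -
    have "f x \<otimes>\<^bsub>H\<^esub> f y = f y \<otimes>\<^bsub>H\<^esub> f x \<longleftrightarrow> x \<otimes>\<^bsub>G\<^esub> y = y \<otimes>\<^bsub>G\<^esub> x" if "y \<in> carrier G" for y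
      using \<open>x \<in> carrier G\<close> that inj_on_eq_iff[OF inj] by (simp flip: mult)
    then show ?thesis
      using that unfolding center_def im[symmetric] by blast
  qed
  have "bij_betw f (center G) (center H)"
    unfolding bij_betw_def
  proof
    show "inj_on f (center G)"
      using inj by (rule inj_on_subset) (auto dest: center_carrier)
    show "f ` center G = center H"
    proof (intro equalityI subsetI)
      fix y assume y: "y \<in> center H"
      then obtain x where x: "x \<in> carrier G" "y = f x"
        using center_carrier[OF y] unfolding im[symmetric] by blast
      then have "x \<in> center G"
        using y iff by blast
      then show "y \<in> f ` center G"
        by (simp add: x)
    next
      fix y assume "y \<in> f ` center G"
      then obtain x where x: "x \<in> center G" "y = f x" ..
      then show "y \<in> center H"
        using iff[OF center_carrier[OF x(1)]] by simp
    qed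
  qed
  moreover have "f \<in> hom (center_group G) (center_group H)"
    by (rule homI) (simp_all add: iff mult center_carrier)
  ultimately have "f \<in> iso (center_group G) (center_group H)"
    by (intro isoI) simp_all
  then show ?thesis
    by (rule is_isoI)
qed

lemma center_group_DirProd:
  assumes "group G" "group H"
  shows "center_group (G \<times>\<times> H) = center_group G \<times>\<times> center_group H"
proof -
  interpret G: group G by fact
  interpret H: group H by fact
  have "center (G \<times>\<times> H) = center G \<times> center H"
  proof (intro equalityI subsetI)
    fix p assume p: "p \<in> center (G \<times>\<times> H)"
    obtain z w where zw: "p = (z, w)" by (cases p)
    have c: "z \<in> carrier G" "w \<in> carrier H"
      using center_carrier[OF p] by (simp_all add: zw)
    have comm: "z \<otimes>\<^bsub>G\<^esub> g = g \<otimes>\<^bsub>G\<^esub> z \<and> w \<otimes>\<^bsub>H\<^esub> h = h \<otimes>\<^bsub>H\<^esub> w"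
      if "g \<in> carrier G" "h \<in> carrier H" for g h
      using center_comm[OF p, of "(g, h)"] that by (simp add: zw)
    \<comment> \<open>Setting the other coordinate to the unit separates the two commutation
      conditions.\<close>
    have "z \<in> center G" "w \<in> center H"
      using c comm[OF _ H.one_closed] comm[OF G.one_closed] by (blast intro: centerI)+
    then show "p \<in> center G \<times> center H"
      by (simp add: zw)
  next
    fix p assume "p \<in> center G \<times> center H"
    then obtain z w where zw: "p = (z, w)" and z: "z \<in> center G" and w: "w \<in> center H"
      by blast
    show "p \<in> center (G \<times>\<times> H)"
      using z w by (auto simp: zw center_carrier center_comm intro!: centerI)
  qed
  then show ?thesis
    by (simp add: DirProd_def)
qed

section \<open>The abelianization\<close>

text \<open>Only one inclusion is required of the kernel: the other one holds whenever \<open>K\<close> is commutative.\<close>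

definition abelianizes :: "('a \<Rightarrow> 'b) \<Rightarrow> ('a, 'c) monoid_scheme \<Rightarrow> ('b, 'd) monoid_scheme \<Rightarrow> bool" where
  "abelianizes f G K \<longleftrightarrow> f \<in> epi G K \<and> kernel G K f \<subseteq> derived G (carrier G)"

text \<open>Serves two purposes: a commutative target makes the right-hand side trivial, and an
  embedding of a factor carries commutators into the derived subgroup of the larger group.\<close>

lemma (in group_hom) derived_img_subset: "h ` derived G (carrier G) \<subseteq> derived H (carrier H)"
  by (metis H.mono_derived derived_img hom_carrier homh order_refl)

text \<open>First isomorphism theorem: commutativity of \<open>K\<close> puts the derived subgroup
  inside the kernel, so the two coincide.\<close>

lemma abelianizes_FactGroup:
  assumes "group G" "comm_group K" "abelianizes f G K"
  shows "G Mod derived G (carrier G) \<cong> K"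
proof -
  interpret K: comm_group K by fact
  interpret group_hom G K f
    using assms by (auto simp: group_hom_def group_hom_axioms_def abelianizes_def epi_def
        K.group_axioms)
  have surj: "f ` carrier G = carrier K"
    using assms(3) by (simp add: abelianizes_def epi_def)
  have "f x = \<one>\<^bsub>K\<^esub>" if "x \<in> derived G (carrier G)" for x
    using derived_img_subset that K.derived_eq_singleton[of "carrier K"] by auto
  then have "derived G (carrier G) \<subseteq> kernel G K f"
    using G.derived_in_carrier[of "carrier G"] by (auto simp: kernel_def)
  then have "kernel G K f = derived G (carrier G)"
    using assms(3) by (auto simp: abelianizes_def)
  then show ?thesis
    using FactGroup_iso[OF surj] by simp
qed

text \<open>An isomorphism maps the derived subgroup onto the derived subgroup, and injectivity
  pulls membership back.\<close>

lemma abelianizes_iso_dom: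
  assumes "group G" "group H" "g \<in> iso G H" "abelianizes f H K"
  shows "abelianizes (f \<circ> g) G K"
proof -
  interpret G: group G by fact
  interpret H: group H by fact
  have g: "g \<in> hom G H" "g ` carrier G = carrier H" "inj_on g (carrier G)"
    using assms(3) by (auto simp: iso_def bij_betw_def)
  interpret group_hom G H g
    by unfold_locales (use g in auto)
  have f: "f \<in> epi H K" "kernel H K f \<subseteq> derived H (carrier H)"
    using assms(4) by (auto simp: abelianizes_def)
  have "x \<in> derived G (carrier G)" if "x \<in> kernel G K (f \<circ> g)" for x
  proof -
    have "g x \<in> kernel H K f" "x \<in> carrier G"
      using that by (auto simp: kernel_def)
    then have "g x \<in> g ` derived G (carrier G)"
      using f(2) derived_img[of "carrier G"] g(2) by auto
    then show ?thesis
      using g(3) \<open>x \<in> carrier G\<close> G.derived_in_carrier[of "carrier G"]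
      by (auto simp: inj_on_def subset_iff)
  qed
  moreover have "f \<circ> g \<in> epi G K"
    using f(1) assms(3) epi_compose iso_iff_mon_epi by blast
  ultimately show ?thesis
    by (auto simp: abelianizes_def)
qed

lemma abelianizes_iso_cod:
  assumes "group H" "group K" "g \<in> iso H K" "abelianizes f G H"
  shows "abelianizes (g \<circ> f) G K"
proof -
  interpret group_hom H K g
    using assms by (auto simp: group_hom_def group_hom_axioms_def iso_def)
  have f: "f \<in> epi G H" "kernel G H f \<subseteq> derived G (carrier G)"
    using assms(4) by (auto simp: abelianizes_def)
  have "kernel G K (g \<circ> f) \<subseteq> kernel G H f"
    using f(1) assms(3) unfolding iso_iff by (auto simp: kernel_def epi_def hom_def)
  moreover have "g \<circ> f \<in> epi G K"
    using f(1) assms(3) epi_compose iso_iff_mon_epi by blast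
  ultimately show ?thesis
    using f(2) by (auto simp: abelianizes_def)
qed

text \<open>A kernel element splits as \<open>(x, \<one>)\<close> times \<open>(\<one>, y)\<close>,
  and each factor is the image of a product of commutators under a coordinate embedding.\<close>

lemma abelianizes_DirProd:
  assumes "group G" "group H" and f: "abelianizes f G K" and g: "abelianizes g H L"
  shows "abelianizes (map_prod f g) (G \<times>\<times> H) (K \<times>\<times> L)"
proof -
  interpret G: group G by fact
  interpret H: group H by fact
  interpret P: group "G \<times>\<times> H" by (rule DirProd_group) fact+
  interpret l: group_hom G "G \<times>\<times> H" "\<lambda>x. (x, \<one>\<^bsub>H\<^esub>)"
    by unfold_locales (auto simp: hom_def)
  interpret r: group_hom H "G \<times>\<times> H" "\<lambda>y. (\<one>\<^bsub>G\<^esub>, y)"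
    by unfold_locales (auto simp: hom_def)
  interpret D: subgroup "derived (G \<times>\<times> H) (carrier (G \<times>\<times> H))" "G \<times>\<times> H"
    by (rule P.derived_is_subgroup) simp
  have "(x, y) \<in> derived (G \<times>\<times> H) (carrier (G \<times>\<times> H))"
    if "(x, y) \<in> kernel (G \<times>\<times> H) (K \<times>\<times> L) (map_prod f g)" for x y
  proof -
    have xy: "x \<in> derived G (carrier G)" "y \<in> derived H (carrier H)"
      and c: "x \<in> carrier G" "y \<in> carrier H"
      using that f g by (auto simp: abelianizes_def kernel_def)
    have "(x, \<one>\<^bsub>H\<^esub>) \<otimes>\<^bsub>G \<times>\<times> H\<^esub> (\<one>\<^bsub>G\<^esub>, y) \<in> derived (G \<times>\<times> H) (carrier (G \<times>\<times> H))"
      using xy l.derived_img_subset r.derived_img_subset by (intro D.m_closed) auto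
    then show ?thesis
      using c by simp
  qed
  moreover have "map_prod f g \<in> epi (G \<times>\<times> H) (K \<times>\<times> L)"
    using f g by (auto simp: abelianizes_def epi_def hom_def map_prod_surj_on)
  ultimately show ?thesis
    unfolding abelianizes_def by auto
qed

section \<open>Wreath products with the integers\<close>

locale wreath_product = group A for A (structure) +
  fixes n :: nat
  assumes n_pos: "1 \<le> n"
begin

text \<open>The index map underlying \<open>cyclic_shift\<close>. As an action of the integers on
  \<open>{..<n}\<close> it reduces modular arithmetic to the rewrite rules below.\<close>

definition rot :: "int \<Rightarrow> nat \<Rightarrow> nat" where
  "rot k i = nat ((int i + k) mod int n)"

lemma rot_less [simp]: "rot k i < n"
  using n_pos by (simp add: rot_def nat_less_iff)

lemma rot_rot [simp]: "rot k (rot h i) = rot (h + k) i"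
  using n_pos by (simp add: rot_def mod_add_left_eq add.assoc)

lemma rot_0 [simp]: "i < n \<Longrightarrow> rot 0 i = i"
  by (simp add: rot_def)

lemma rot_start: "j < n \<Longrightarrow> rot (int j) 0 = j"
  by (simp add: rot_def)

text \<open>Locates the support of a shifted tuple: shifting by \<open>i\<close> brings the entry at
  coordinate \<open>i\<close> to coordinate 0 and nowhere else, because rotations are
  invertible.\<close>

lemma rot_self_iff:
  assumes "j < n" "i < n"
  shows "rot (int i) j = i \<longleftrightarrow> j = 0"
proof
  assume "rot (int i) j = i"
  then have "rot (int i) j = rot (int i) 0"
    using assms by (simp add: rot_start)
  then have "rot (- int i) (rot (int i) j) = rot (- int i) (rot (int i) 0)"
    by simp
  then show "j = 0"
    using assms by (subst (asm) (1 2) rot_rot) auto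
qed (use assms in \<open>simp add: rot_start\<close>)

lemma bij_rot: "bij_betw (rot k) {..<n} {..<n}"
  by (rule bij_betw_byWitness[where f' = "rot (- k)"]) auto

lemma rot_add_multiple: "i < n \<Longrightarrow> rot (int n * k) i = i"
  by (simp add: rot_def)

lemma rot_zero_eq_0_iff: "rot k 0 = 0 \<longleftrightarrow> int n dvd k"
  using n_pos by (auto simp: rot_def dvd_eq_mod_eq_0 intro: antisym)

lemma cyclic_shift_eq: "cyclic_shift n k a = (\<lambda>i\<in>{..<n}. a (rot k i))"
  by (simp add: cyclic_shift_def rot_def)

section \<open>The wreath product in coordinates and its group axioms\<close>

abbreviation W :: "((nat \<Rightarrow> 'a) \<times> int) monoid" where
  "W \<equiv> wreath_int A n"

lemma carrier_W: "carrier W = {a \<in> extensional {..<n}. \<forall>i<n. a i \<in> carrier A} \<times> UNIV"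
  by (auto simp: wreath_int_def semidirect_product_def PiE_def)

lemma mult_W: "(a, h) \<otimes>\<^bsub>W\<^esub> (b, k) = (\<lambda>i\<in>{..<n}. a i \<otimes> b (rot h i), h + k)"
  by (auto simp: wreath_int_def semidirect_product_def cyclic_shift_eq)

lemma one_W: "\<one>\<^bsub>W\<^esub> = (\<lambda>i\<in>{..<n}. \<one>, 0)"
  by (simp add: wreath_int_def semidirect_product_def)

lemma group_W: "group W"
proof (rule groupI)
  fix x y assume "x \<in> carrier W" "y \<in> carrier W"
  then show "x \<otimes>\<^bsub>W\<^esub> y \<in> carrier W"
    by (cases x; cases y) (simp add: carrier_W mult_W)
next
  show "\<one>\<^bsub>W\<^esub> \<in> carrier W"
    by (simp add: carrier_W one_W)
next
  fix x y z assume "x \<in> carrier W" "y \<in> carrier W" "z \<in> carrier W"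
  then obtain a h b k c l where [simp]: "x = (a, h)" "y = (b, k)" "z = (c, l)"
    and [simp]: "\<And>i. i < n \<Longrightarrow> a i \<in> carrier A" "\<And>i. i < n \<Longrightarrow> b i \<in> carrier A"
      "\<And>i. i < n \<Longrightarrow> c i \<in> carrier A"
    by (cases x; cases y; cases z) (simp add: carrier_W)
  show "x \<otimes>\<^bsub>W\<^esub> y \<otimes>\<^bsub>W\<^esub> z = x \<otimes>\<^bsub>W\<^esub> (y \<otimes>\<^bsub>W\<^esub> z)"
    by (simp add: mult_W m_assoc fun_eq_iff)
next
  fix x assume "x \<in> carrier W"
  then obtain a h where x: "x = (a, h)" and ext: "a \<in> extensional {..<n}"
    and a [simp]: "\<And>i. i < n \<Longrightarrow> a i \<in> carrier A"
    by (cases x) (simp add: carrier_W)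
  show "\<one>\<^bsub>W\<^esub> \<otimes>\<^bsub>W\<^esub> x = x"
    using ext unfolding x one_W mult_W prod.inject
    by (intro conjI extensionalityI[of _ "{..<n}"]) simp_all
  show "\<exists>y\<in>carrier W. y \<otimes>\<^bsub>W\<^esub> x = \<one>\<^bsub>W\<^esub>"
  proof
    \<comment> \<open>The inverse in a semidirect product: the inverted tuple, shifted back by
      \<open>h\<close>.\<close>
    show "(\<lambda>i\<in>{..<n}. inv (a (rot (- h) i)), - h) \<in> carrier W"
      by (simp add: carrier_W)
    show "(\<lambda>i\<in>{..<n}. inv (a (rot (- h) i)), - h) \<otimes>\<^bsub>W\<^esub> x = \<one>\<^bsub>W\<^esub>"
      by (simp add: x mult_W one_W fun_eq_iff)
  qed
qed

subsection \<open>Center of a wreath product\<close>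

definition const :: "'a \<Rightarrow> nat \<Rightarrow> 'a" where
  "const z = (\<lambda>i\<in>{..<n}. z)"

lemma const_apply [simp]: "i < n \<Longrightarrow> const z i = z"
  by (simp add: const_def)

lemma const_extensional [simp]: "const z \<in> extensional {..<n}"
  by (simp add: const_def)

lemma const_eq_iff [simp]: "const z = const w \<longleftrightarrow> z = w"
proof
  assume "const z = const w"
  then have "const z 0 = const w 0"
    by simp
  then show "z = w"
    using n_pos by (simp add: const_def)
qed simp

text \<open>The generator of the projection of the center to the integers: the integers act trivially on
  the powers of a trivial group.\<close>

definition center_period :: int where
  "center_period = (if carrier A = {\<one>} then 1 else int n)"

lemma center_period_nonzero: "center_period \<noteq> 0"
  using n_pos by (simp add: center_period_def)

text \<open>If \<open>A\<close> is trivial, all entries agree whatever the shift; otherwise a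
  multiple of \<open>n\<close> rotates every index to itself.\<close>

lemma apply_rot_center_period:
  assumes "\<And>i. i < n \<Longrightarrow> b i \<in> carrier A" "i < n"
  shows "b (rot (center_period * k) i) = b i"
proof (cases "carrier A = {\<one>}")
  case True
  then have "b j = \<one>" if "j < n" for j
    using assms(1)[OF that] by simp
  then show ?thesis
    using assms by simp
next
  case False
  then show ?thesis
    using assms by (simp add: center_period_def rot_add_multiple)
qed

text \<open>Commuting with \<open>(b, h)\<close> means
  \<open>a i \<otimes> b (rot k i) = b i \<otimes> a (rot h i)\<close> for all \<open>i < n\<close>;
  suitable choices of \<open>b\<close> and \<open>h\<close> determine \<open>a\<close> and restrict
  \<open>k\<close>.\<close>

lemma center_W: "center W = (\<lambda>(z, k). (const z, center_period * k)) ` (center A \<times> UNIV)"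
proof (intro equalityI subsetI)
  fix x assume x: "x \<in> center W"
  then obtain a k where ak: "x = (a, k)" and ext: "a \<in> extensional {..<n}"
    and a: "\<And>i. i < n \<Longrightarrow> a i \<in> carrier A"
    using center_carrier[OF x] by (cases x) (simp add: carrier_W)
  have n0: "0 < n"
    using n_pos by simp
  define z where "z = a 0"
  have z: "z \<in> carrier A"
    using a n0 by (simp add: z_def)
  have comm: "a i \<otimes> b (rot k i) = b i \<otimes> a (rot h i)"
    if "b \<in> extensional {..<n}" "\<And>i. i < n \<Longrightarrow> b i \<in> carrier A" "i < n" for b h i
  proof -
    have "(a, k) \<otimes>\<^bsub>W\<^esub> (b, h) = (b, h) \<otimes>\<^bsub>W\<^esub> (a, k)"
      using center_comm[OF x, of "(b, h)"] that by (simp add: ak carrier_W)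
    then have "(\<lambda>i\<in>{..<n}. a i \<otimes> b (rot k i)) i = (\<lambda>i\<in>{..<n}. b i \<otimes> a (rot h i)) i"
      unfolding mult_W prod.inject by simp
    then show ?thesis
      using that(3) by simp
  qed
  have "a j = z" if "j < n" for j
  proof -
    \<comment> \<open>A trivial tuple with shift \<open>j\<close> compares entry 0 with entry
      \<open>j\<close>.\<close>
    have "a 0 \<otimes> const \<one> (rot k 0) = const \<one> 0 \<otimes> a (rot (int j) 0)"
      using n0 by (intro comm) simp_all
    then show ?thesis
      using that a n0 by (simp add: rot_start z_def)
  qed
  then have a_eq: "a = const z"
    using ext by (intro extensionalityI[of _ "{..<n}"]) simp_all
  have "z \<in> center A"
  proof (rule centerI)
    fix g assume "g \<in> carrier A"
    then show "z \<otimes> g = g \<otimes> z"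
      using comm[of "const g" 0 0] n0 by (simp add: a_eq)
  qed (fact z)
  moreover have "center_period dvd k"
  proof (cases "carrier A = {\<one>}")
    case False
    then obtain g where g: "g \<in> carrier A" "g \<noteq> \<one>"
      using one_closed by blast
    \<comment> \<open>A tuple supported at coordinate 0 alone detects whether the shift by
      \<open>k\<close> fixes that coordinate.\<close>
    define b where "b = (\<lambda>i\<in>{..<n}. if i = 0 then g else \<one>)"
    have b: "b \<in> extensional {..<n}" "\<And>i. i < n \<Longrightarrow> b i \<in> carrier A"
      using g by (simp_all add: b_def)
    have "z \<otimes> b (rot k 0) = b 0 \<otimes> z"
      using comm[OF b n0, of 0] n0 by (simp add: a_eq)
    also have "\<dots> = z \<otimes> b 0"
      using b n0 by (intro center_comm[symmetric] \<open>z \<in> center A\<close>)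
    finally have "b (rot k 0) = b 0"
      using b z n0 by simp
    then have "rot k 0 = 0"
      using g n0 by (simp add: b_def split: if_splits)
    then show ?thesis
      using False by (simp add: rot_zero_eq_0_iff center_period_def)
  qed (simp add: center_period_def)
  ultimately show "x \<in> (\<lambda>(z, k). (const z, center_period * k)) ` (center A \<times> UNIV)"
    unfolding ak a_eq by (auto elim!: dvdE)
next
  fix x assume "x \<in> (\<lambda>(z, k). (const z, center_period * k)) ` (center A \<times> UNIV)"
  then obtain z k where x: "x = (const z, center_period * k)" and z: "z \<in> center A"
    by auto
  show "x \<in> center W"
  proof (rule centerI)
    show "x \<in> carrier W"
      using center_carrier[OF z] by (simp add: x carrier_W)
    fix y assume "y \<in> carrier W"
    then obtain b h where y: "y = (b, h)" and b: "\<And>i. i < n \<Longrightarrow> b i \<in> carrier A"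
      by (cases y) (simp add: carrier_W)
    have "z \<otimes> b i = b i \<otimes> z" if "i < n" for i
      by (rule center_comm[OF z b[OF that]])
    then show "x \<otimes>\<^bsub>W\<^esub> y = y \<otimes>\<^bsub>W\<^esub> x"
      using b by (simp add: x y mult_W apply_rot_center_period fun_eq_iff add.commute)
  qed
qed

text \<open>The parametrization in \<open>center_W\<close> is injective because the period is
  nonzero, so its multiples form a copy of the integers.\<close>

lemma center_group_W: "center_group W \<cong> center_group A \<times>\<times> integer_group"
proof -
  interpret C: group "center_group A \<times>\<times> integer_group"
    by (intro DirProd_group group_center group_axioms group_integer_group)
  let ?h = "\<lambda>(z, k). (const z, center_period * k)"
  have "?h \<in> hom (center_group A \<times>\<times> integer_group) (center_group W)"
  proof (rule homI)
    fix x y assume "x \<in> carrier (center_group A \<times>\<times> integer_group)"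
      "y \<in> carrier (center_group A \<times>\<times> integer_group)"
    show "?h (x \<otimes>\<^bsub>center_group A \<times>\<times> integer_group\<^esub> y) = ?h x \<otimes>\<^bsub>center_group W\<^esub> ?h y"
      by (cases x; cases y) (simp add: mult_W const_def fun_eq_iff distrib_left)
  qed (auto simp: center_W)
  moreover have "bij_betw ?h (carrier (center_group A \<times>\<times> integer_group)) (carrier (center_group W))"
    unfolding bij_betw_def
    by (intro conjI inj_onI) (auto simp: center_W center_period_nonzero)
  ultimately have "?h \<in> iso (center_group A \<times>\<times> integer_group) (center_group W)"
    by (rule isoI)
  then show ?thesis
    using C.iso_sym is_isoI by blast
qed

subsection \<open>Abelianization of a wreath product\<close>

definition embed :: "nat \<Rightarrow> 'a \<Rightarrow> (nat \<Rightarrow> 'a) \<times> int" where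
  "embed i x = (\<lambda>j\<in>{..<n}. if j = i then x else \<one>, 0)"

text \<open>The integer component is 0, so no shift enters the products. For \<open>i\<close>
  outside \<open>{..<n}\<close> the map is the trivial homomorphism.\<close>

lemma embed_hom: "embed i \<in> hom A W"
  by (rule homI) (auto simp: embed_def carrier_W mult_W fun_eq_iff)

text \<open>Commutativity of \<open>K\<close> makes the product over all coordinates insensitive to
  shifts. The kernel is controlled by computing in the quotient of \<open>W\<close> by its derived
  subgroup.\<close>

lemma abelianizes_W:
  assumes "comm_group K" "abelianizes f A K"
  shows "abelianizes (\<lambda>(a, k). (\<Otimes>\<^bsub>K\<^esub>i\<in>{..<n}. f (a i), k)) W (K \<times>\<times> integer_group)"
proof -
  let ?F = "\<lambda>(a, k). (\<Otimes>\<^bsub>K\<^esub>i\<in>{..<n}. f (a i), k :: int)"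
  interpret W: group W by (rule group_W)
  interpret K: comm_group K by fact
  have f: "f \<in> hom A K" "f ` carrier A = carrier K" "kernel A K f \<subseteq> derived A (carrier A)"
    using assms(2) by (auto simp: abelianizes_def epi_def)
  interpret f: group_hom A K f
    by unfold_locales (rule f)
  have F_hom: "?F \<in> hom W (K \<times>\<times> integer_group)"
  proof (rule homI)
    fix x y assume "x \<in> carrier W" "y \<in> carrier W"
    then obtain a h b k where xy: "x = (a, h)" "y = (b, k)"
      and ab: "\<And>i. i < n \<Longrightarrow> a i \<in> carrier A" "\<And>i. i < n \<Longrightarrow> b i \<in> carrier A"
      by (cases x; cases y) (simp add: carrier_W)
    \<comment> \<open>Rotation permutes the index set, so the shifted \<open>b\<close> contributes
      the same product as \<open>b\<close>.\<close>
    have "(\<Otimes>\<^bsub>K\<^esub>i\<in>{..<n}. f (b (rot h i))) = (\<Otimes>\<^bsub>K\<^esub>i\<in>rot h ` {..<n}. f (b i))"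
      using ab bij_rot[of h] by (intro K.finprod_reindex[symmetric]) (auto simp: bij_betw_def)
    also have "rot h ` {..<n} = {..<n}"
      using bij_rot by (simp add: bij_betw_def)
    finally have "(\<Otimes>\<^bsub>K\<^esub>i\<in>{..<n}. f (a i \<otimes> b (rot h i)))
        = (\<Otimes>\<^bsub>K\<^esub>i\<in>{..<n}. f (a i)) \<otimes>\<^bsub>K\<^esub> (\<Otimes>\<^bsub>K\<^esub>i\<in>{..<n}. f (b i))"
      using ab by (simp add: K.finprod_multf Pi_iff cong: K.finprod_cong)
    moreover have "(\<Otimes>\<^bsub>K\<^esub>i\<in>{..<n}. f ((\<lambda>i\<in>{..<n}. a i \<otimes> b (rot h i)) i))
        = (\<Otimes>\<^bsub>K\<^esub>i\<in>{..<n}. f (a i \<otimes> b (rot h i)))"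
      using ab by (intro K.finprod_cong') auto
    ultimately show "?F (x \<otimes>\<^bsub>W\<^esub> y) = ?F x \<otimes>\<^bsub>K \<times>\<times> integer_group\<^esub> ?F y"
      by (simp add: xy mult_W)
  next
    fix x assume "x \<in> carrier W"
    then show "?F x \<in> carrier (K \<times>\<times> integer_group)"
      by (cases x) (auto simp: carrier_W intro!: K.finprod_closed)
  qed
  have F_surj: "?F ` carrier W = carrier (K \<times>\<times> integer_group)"
  proof
    show "?F ` carrier W \<subseteq> carrier (K \<times>\<times> integer_group)"
      using F_hom unfolding hom_def by blast
    show "carrier (K \<times>\<times> integer_group) \<subseteq> ?F ` carrier W"
    proof
      fix p assume "p \<in> carrier (K \<times>\<times> integer_group)"
      then obtain x k where p: "p = (f x, k)" and x: "x \<in> carrier A"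
        using f(2) by (cases p) auto
      \<comment> \<open>Only the tuple of \<open>embed 0 x\<close> is taken, so that it can be
        paired with an arbitrary \<open>k\<close>.\<close>
      have "(\<Otimes>\<^bsub>K\<^esub>i\<in>{..<n}. f (fst (embed 0 x) i)) = (\<Otimes>\<^bsub>K\<^esub>i\<in>{..<n}. if 0 = i then f x else \<one>\<^bsub>K\<^esub>)"
        using x by (intro K.finprod_cong') (auto simp: embed_def)
      also have "\<dots> = f x"
        using x n_pos by (intro K.finprod_singleton) auto
      finally have "?F (fst (embed 0 x), k) = p"
        by (simp add: p)
      moreover have "(fst (embed 0 x), k) \<in> carrier W"
        using x by (auto simp: embed_def carrier_W)
      ultimately show "p \<in> ?F ` carrier W"
        by blast
    qed
  qed
  let ?D = "derived W (carrier W)"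
  interpret D: normal ?D W
    by (rule W.derived_self_is_normal)
  interpret Q: comm_group "W Mod ?D"
    by (rule W.derived_quot_is_comm_group)
  let ?q = "\<lambda>x. ?D #>\<^bsub>W\<^esub> x"
  interpret q: group_hom W "W Mod ?D" ?q
    by unfold_locales (rule D.r_coset_hom_Mod)
  interpret e: group_hom A W "embed i" for i
    by unfold_locales (rule embed_hom)
  have q_embed: "?q (embed i x) = ?q (embed 0 x)" if i: "i < n" and x: "x \<in> carrier A" for i x
  proof -
    \<comment> \<open>The pure shift by \<open>i\<close> conjugates the copy of \<open>A\<close> at
      coordinate \<open>i\<close> to the one at coordinate 0, and conjugation is invisible in a
      commutative quotient.\<close>
    define t where "t = (const \<one>, int i)"
    have t: "t \<in> carrier W"
      by (simp add: t_def carrier_W)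
    have "t \<otimes>\<^bsub>W\<^esub> embed i x = embed 0 x \<otimes>\<^bsub>W\<^esub> t"
      using i x by (auto simp: t_def embed_def mult_W fun_eq_iff rot_self_iff)
    then have "?q t \<otimes>\<^bsub>W Mod ?D\<^esub> ?q (embed i x) = ?q (embed 0 x) \<otimes>\<^bsub>W Mod ?D\<^esub> ?q t"
      using t x by (metis e.hom_closed q.hom_mult)
    also have "\<dots> = ?q t \<otimes>\<^bsub>W Mod ?D\<^esub> ?q (embed 0 x)"
      using t x by (intro Q.m_comm q.hom_closed e.hom_closed)
    finally show ?thesis
      using t x by (metis Q.l_cancel e.hom_closed q.hom_closed)
  qed
  have "y \<in> ?D" if y: "y \<in> kernel W (K \<times>\<times> integer_group) ?F" for y
  proof -
    obtain a where ya: "y = (a, 0)" and ext: "a \<in> extensional {..<n}"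
      and ai: "\<And>i. i < n \<Longrightarrow> a i \<in> carrier A" and prod: "(\<Otimes>\<^bsub>K\<^esub>i\<in>{..<n}. f (a i)) = \<one>\<^bsub>K\<^esub>"
      using y by (cases y) (simp add: kernel_def carrier_W)
    \<comment> \<open>Prefixes of \<open>a\<close>: \<open>trunc 0\<close> is the identity and
      \<open>trunc n\<close> is \<open>y\<close>.\<close>
    define trunc where "trunc j = (\<lambda>i\<in>{..<n}. if i < j then a i else \<one>, 0::int)" for j
    \<comment> \<open>Modulo commutators the coordinates can all be moved to position 0 and multiplied there.\<close>
    have "\<exists>x\<in>carrier A. f x = (\<Otimes>\<^bsub>K\<^esub>i\<in>{..<j}. f (a i)) \<and> ?q (trunc j) = ?q (embed 0 x)"
      if "j \<le> n" for j
      using that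
    proof (induction j)
      case 0
      have "trunc 0 = embed 0 \<one>"
        by (auto simp: trunc_def embed_def)
      then show ?case
        by (intro bexI[of _ "\<one>"]) auto
    next
      case (Suc j)
      then obtain x where x: "x \<in> carrier A" "f x = (\<Otimes>\<^bsub>K\<^esub>i\<in>{..<j}. f (a i))"
        and q: "?q (trunc j) = ?q (embed 0 x)"
        by auto
      have aj: "a j \<in> carrier A"
        using Suc.prems by (intro ai) simp
      have tj: "trunc j \<in> carrier W"
        using ai by (auto simp: trunc_def carrier_W)
      \<comment> \<open>Coordinate \<open>j\<close> is still trivial in \<open>trunc j\<close>, so
        the factor at \<open>j\<close> just fills it in.\<close>
      have "trunc (Suc j) = trunc j \<otimes>\<^bsub>W\<^esub> embed j (a j)"
        using ai by (auto simp: trunc_def embed_def mult_W fun_eq_iff less_Suc_eq)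
      then have "?q (trunc (Suc j)) = ?q (embed 0 x) \<otimes>\<^bsub>W Mod ?D\<^esub> ?q (embed 0 (a j))"
        using Suc.prems aj tj q_embed[of j "a j"] q by simp
      also have "\<dots> = ?q (embed 0 (x \<otimes> a j))"
        using x(1) aj by simp
      finally have 1: "?q (trunc (Suc j)) = ?q (embed 0 (x \<otimes> a j))" .
      have "(\<Otimes>\<^bsub>K\<^esub>i\<in>{..<Suc j}. f (a i)) = f (a j) \<otimes>\<^bsub>K\<^esub> (\<Otimes>\<^bsub>K\<^esub>i\<in>{..<j}. f (a i))"
        unfolding lessThan_Suc using ai Suc.prems by (intro K.finprod_insert) auto
      \<comment> \<open>The inserted factor stands first, while \<open>x \<otimes> a j\<close> has
        it last; commutativity of \<open>K\<close> swaps them.\<close>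
      also have "\<dots> = f (x \<otimes> a j)"
        using x aj by (simp add: K.m_comm flip: x(2))
      finally show ?case
        using 1 x(1) aj by (intro bexI[of _ "x \<otimes> a j"]) auto
    qed
    from this[of n] obtain x where x: "x \<in> carrier A" "f x = \<one>\<^bsub>K\<^esub>" "?q (trunc n) = ?q (embed 0 x)"
      using prod by auto
    have "x \<in> derived A (carrier A)"
      using x f(3) by (auto simp: kernel_def)
    then have "embed 0 x \<in> ?D"
      using e.derived_img_subset by blast
    moreover have "trunc n = y"
      using ext unfolding trunc_def ya prod.inject
      by (intro conjI extensionalityI[of _ "{..<n}"]) simp_all
    moreover have "y \<in> carrier W"
      using y by (simp add: kernel_def)
    ultimately show "y \<in> ?D"
      \<comment> \<open>The coset of \<open>y\<close> is that of \<open>embed 0 x\<close>, hence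
        \<open>?D\<close> itself, and \<open>y\<close> lies in its own coset.\<close>
      using x(3) W.rcos_self[OF _ D.is_subgroup, of y] D.rcos_const[of "embed 0 x"] by simp
  qed
  then show ?thesis
    using F_hom F_surj unfolding abelianizes_def epi_def by blast
qed

end

section \<open>Groups determined by words\<close>

text \<open>The invariant of the induction on words. The abelianization is recorded as a map instead
  of a quotient, so that it can be composed and paired.\<close>

definition has_rank :: "('a, 'c) monoid_scheme \<Rightarrow> nat \<Rightarrow> bool" where
  "has_rank G m \<longleftrightarrow>
     group G \<and> center_group G \<cong> int_lattice m \<and> (\<exists>f. abelianizes f G (int_lattice m))"

lemma group_int_lattice: "group (int_lattice m)"
  by simp

text \<open>Lets center and abelianization be computed in a convenient model \<open>K\<close> before
  it is identified with a lattice.\<close>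

lemma has_rankI:
  assumes "group G" "center_group G \<cong> K" "abelianizes f G K" "group K" "K \<cong> int_lattice m"
  shows "has_rank G m"
proof -
  obtain g where g: "g \<in> iso K (int_lattice m)"
    using assms(5) by (auto simp: is_iso_def)
  show ?thesis
    unfolding has_rank_def
    using assms(1) iso_trans[OF assms(2,5)]
      abelianizes_iso_cod[OF assms(4) group_int_lattice g assms(3)] by blast
qed

lemma has_rank_iso:
  assumes "has_rank G m" "group H" "G \<cong> H"
  shows "has_rank H m"
proof -
  have G: "group G" and center: "center_group G \<cong> int_lattice m"
    using assms(1) by (simp_all add: has_rank_def)
  obtain f where f: "abelianizes f G (int_lattice m)"
    using assms(1) unfolding has_rank_def by blast
  have HG: "H \<cong> G"
    using G assms(3) by (rule group.iso_sym)
  then obtain g where "g \<in> iso H G"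
    by (auto simp: is_iso_def)
  then have "abelianizes (f \<circ> g) H (int_lattice m)"
    using assms(2) G f by (intro abelianizes_iso_dom)
  then show ?thesis
    unfolding has_rank_def
    using assms(2) iso_trans[OF center_group_iso[OF assms(2) HG] center] by blast
qed

text \<open>Base case for the words without operations: the center is everything, and the identity
  abelianizes because both its kernel and the derived subgroup are trivial.\<close>

lemma has_rank_comm_group:
  assumes "comm_group K" "K \<cong> int_lattice m"
  shows "has_rank K m"
proof (rule has_rankI)
  interpret comm_group K by fact
  have "center K = carrier K"
    by (auto simp: m_comm dest: center_carrier intro: centerI)
  then show "center_group K \<cong> K"
    by (intro is_isoI[of id] isoI) (auto simp: hom_def)
  have "id \<in> epi K K"
    by (auto simp: epi_def hom_def)
  moreover have "kernel K K id \<subseteq> derived K (carrier K)"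
    by (auto simp: kernel_def derived_eq_singleton)
  ultimately show "abelianizes id K K"
    by (simp add: abelianizes_def)
qed (use assms comm_group.axioms in auto)

lemma has_rank_DirProd:
  assumes "has_rank G m" "has_rank H k"
  shows "has_rank (G \<times>\<times> H) (m + k)"
proof -
  obtain f g where "abelianizes f G (int_lattice m)" "abelianizes g H (int_lattice k)"
    using assms unfolding has_rank_def by blast
  moreover have "group G" "group H" "center_group G \<cong> int_lattice m" "center_group H \<cong> int_lattice k"
    using assms by (simp_all add: has_rank_def)
  ultimately show ?thesis
    using int_lattice_add[of m k]
    by (intro has_rankI[of _ "int_lattice m \<times>\<times> int_lattice k" "map_prod f g"] abelianizes_DirProd)
       (auto simp: DirProd_group center_group_DirProd
          intro: group.DirProd_iso_trans group_center)
qed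

text \<open>Center and abelianization each gain one integer factor, which accounts for the summand
  1.\<close>

lemma has_rank_wreath_int:
  assumes "has_rank G m" "1 \<le> n"
  shows "has_rank (wreath_int G n) (m + 1)"
proof -
  interpret wreath_product G n
    using assms by (simp add: has_rank_def wreath_product_def wreath_product_axioms_def)
  obtain f where f: "abelianizes f G (int_lattice m)"
    using assms unfolding has_rank_def by blast
  have lattice: "int_lattice m \<times>\<times> integer_group \<cong> int_lattice (m + 1)"
    by (rule iso_trans[OF group.DirProd_iso_trans[OF group_int_lattice iso_refl] int_lattice_add])
       (rule group.iso_sym[OF group_int_lattice int_lattice_1])
  have "center_group G \<times>\<times> integer_group \<cong> int_lattice m \<times>\<times> integer_group"
    using assms by (intro group.DirProd_iso_trans group_center iso_refl) (simp_all add: has_rank_def)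
  then have "center_group W \<cong> int_lattice m \<times>\<times> integer_group"
    by (rule iso_trans[OF center_group_W])
  then show ?thesis
    using group_W abelianizes_W[OF comm_group_int_lattice f] lattice
    by (intro has_rankI) (auto simp: DirProd_group)
qed

text \<open>Carries the result over to the type \<open>elt\<close>, along its injective
  constructors.\<close>

lemma has_rank_image_group:
  assumes "has_rank G m" "inj f"
  shows "has_rank (image_group f G) m"
proof -
  have f: "f \<in> iso G (image_group f G)"
    using inj_on_subset[OF assms(2)] by (intro inj_imp_image_group_iso) simp
  have G: "group G"
    using assms(1) by (simp add: has_rank_def)
  have "group (image_group f G)"
    using inj_on_subset[OF assms(2)] by (intro group.inj_imp_image_group_is_group[OF G]) simp
  then show ?thesis
    by (rule has_rank_iso[OF assms(1) _ is_isoI[OF f]])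
qed

lemma has_rank_word_group: "valid_word \<omega> \<Longrightarrow> has_rank (word_group \<omega>) (\<beta>\<^sub>1 \<omega>)"
proof (induction \<omega>)
  case WOne
  have "singleton_group EOne \<cong> int_lattice 0"
    by (rule group.iso_sym[OF group_int_lattice int_lattice_0])
  then show ?case
    by (simp add: has_rank_comm_group)
next
  case WInt
  have "integer_group \<cong> int_lattice 1"
    by (rule group.iso_sym[OF group_int_lattice int_lattice_1])
  then have "has_rank integer_group 1"
    by (intro has_rank_comm_group abelian_integer_group)
  then show ?case
    by (simp add: has_rank_image_group inj_def)
next
  case (WProd \<alpha> \<beta>)
  then show ?case
    by (simp add: has_rank_image_group has_rank_DirProd inj_def)
next
  case (WWreath \<alpha> n)
  then have "has_rank (wreath_int (word_group \<alpha>) n) (\<beta>\<^sub>1 \<alpha> + 1)"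
    by (intro has_rank_wreath_int) auto
  then show ?case
    by (simp add: has_rank_image_group inj_def)
qed

section \<open>From words to a given group\<close>

lemma group_wreath_class: "wreath_class G \<Longrightarrow> group G"
  by (induction rule: wreath_class.induct) (auto simp: trivial_group_def)

theorem theorem1p2:
  fixes G :: "'a monoid" and \<omega> :: word
  assumes "wreath_class G" and "presentation \<omega> G"
  shows "G\<lparr>carrier := center G\<rparr> \<cong> G Mod derived G (carrier G)
    \<and> G Mod derived G (carrier G) \<cong> product_group {..<\<beta>\<^sub>1 \<omega>} (\<lambda>_. integer_group)
    \<and> (\<forall>\<omega>'. presentation \<omega>' G \<longrightarrow> \<beta>\<^sub>1 \<omega>' = \<beta>\<^sub>1 \<omega>)"
proof -
  have G: "group G"
    using assms(1) by (rule group_wreath_class)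
  \<comment> \<open>Stated for every presentation, since the last claim compares two of
    them.\<close>
  have rank: "has_rank G (\<beta>\<^sub>1 \<omega>')" if "presentation \<omega>' G" for \<omega>'
    using that G unfolding presentation_def by (metis has_rank_iso has_rank_word_group)
  have center: "center_group G \<cong> int_lattice (\<beta>\<^sub>1 \<omega>')" if "presentation \<omega>' G" for \<omega>'
    using rank[OF that] by (simp add: has_rank_def)
  have lattice: "int_lattice (\<beta>\<^sub>1 \<omega>') \<cong> center_group G" if "presentation \<omega>' G" for \<omega>'
    by (rule group.iso_sym[OF group_center[OF G] center[OF that]])
  obtain f where "abelianizes f G (int_lattice (\<beta>\<^sub>1 \<omega>))"
    using rank[OF assms(2)] unfolding has_rank_def by blast
  then have ab: "G Mod derived G (carrier G) \<cong> int_lattice (\<beta>\<^sub>1 \<omega>)"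
    by (rule abelianizes_FactGroup[OF G comm_group_int_lattice])
  have "group (G Mod derived G (carrier G))"
    using group.derived_quot_is_comm_group[OF G] by (rule comm_group.axioms(2))
  then have "int_lattice (\<beta>\<^sub>1 \<omega>) \<cong> G Mod derived G (carrier G)"
    using ab by (rule group.iso_sym)
  then have "center_group G \<cong> G Mod derived G (carrier G)"
    by (rule iso_trans[OF center[OF assms(2)]])
  \<comment> \<open>Both lattices are isomorphic to the center of \<open>G\<close>, so their ranks
    agree.\<close>
  moreover have "\<beta>\<^sub>1 \<omega>' = \<beta>\<^sub>1 \<omega>" if "presentation \<omega>' G" for \<omega>'
    by (rule int_lattice_iso_imp_eq[OF iso_trans[OF lattice[OF that] center[OF assms(2)]]])
  ultimately show ?thesis
    using ab by blast
qed

end
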